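(* Let $m\ge 1$. If $h^d$ and $\tilde h^d$ are two step-down procedures with threshold functions $\tau^d_\alpha$ and $\tilde\tau^d_\alpha$, then their intersection is the step-down procedure $h$ with threshold function $\tau_\alpha(i)=\min(\tau^d_\alpha(i),\tilde\tau^d_\alpha(i))$, $i\in\{1,\ldots,m\}$; that is, $h(p,\alpha)=h^d(p,\alpha)\cap\tilde h^d(p,\alpha)$ for all $p\in[0,1]^m$ and $\alpha\in[0,1]$. Moreover, if $\tau^d_\alpha$ and $\tilde\tau^d_\alpha$ both satisfy the conditions (1) the threshold function at $i$ is non-decreasing in $i$ for each fixed $\alpha$, and (2) the threshold function at $i$ is continuous and non-decreasing in $\alpha$ for each fixed $i$, then so does $\tau_\alpha$.
   Context: For $p\in[0,1]^m$ let $p_{(1)}\le\cdots\le p_{(m)}$ be its ordered entries. A threshold function is a family of maps $\tau_\alpha:\{1,\ldots,m\}\to[0,1]$, $\alpha\in[0,1]$. The step-down procedure with threshold function $\tau_\alpha$ is the map sending $(p,\alpha)\in[0,1]^m\times[0,1]$ to the set of indices of rejected hypotheses $$\left\{i\in\{1,\ldots,m\}: p_i<\min\{p_{(j)}: p_{(j)}>\tau_\alpha(j)\}\right\},$$ where the minimum over the empty set is $+\infty$ (all hypotheses rejected). *)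

theory Defs
  imports "HOL-Analysis.Analysis"
begin

text \<open>A point of $[0,1]^m$ is a function in \<open>{1..m} \<rightarrow> {0..1}\<close>; its values outside
  \<open>{1..m}\<close> are never used.  In \<open>\<tau> \<alpha> i\<close> the level \<open>\<alpha>\<close> comes first and the rank \<open>i\<close> second.\<close>

definition order_stat :: "nat \<Rightarrow> (nat \<Rightarrow> real) \<Rightarrow> nat \<Rightarrow> real" where
  "order_stat m p j = sort (map p [1..<Suc m]) ! (j - 1)"

definition threshold_function :: "nat \<Rightarrow> (real \<Rightarrow> nat \<Rightarrow> real) \<Rightarrow> bool" where
  "threshold_function m \<tau> \<longleftrightarrow> (\<forall>\<alpha>\<in>{0..1}. \<tau> \<alpha> \<in> {1..m} \<rightarrow> {0..1})"

definition step_down_bound ::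
    "nat \<Rightarrow> (real \<Rightarrow> nat \<Rightarrow> real) \<Rightarrow> (nat \<Rightarrow> real) \<Rightarrow> real \<Rightarrow> ereal" where
  "step_down_bound m \<tau> p \<alpha> =
     (let S = {order_stat m p j | j. j \<in> {1..m} \<and> order_stat m p j > \<tau> \<alpha> j}
      in if S = {} then \<infinity> else ereal (Min S))"

definition step_down ::
    "nat \<Rightarrow> (real \<Rightarrow> nat \<Rightarrow> real) \<Rightarrow> (nat \<Rightarrow> real) \<Rightarrow> real \<Rightarrow> nat set" where
  "step_down m \<tau> p \<alpha> = {i \<in> {1..m}. ereal (p i) < step_down_bound m \<tau> p \<alpha>}"

definition threshold_mono_index :: "nat \<Rightarrow> (real \<Rightarrow> nat \<Rightarrow> real) \<Rightarrow> bool" where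
  "threshold_mono_index m \<tau> \<longleftrightarrow> (\<forall>\<alpha>\<in>{0..1}. mono_on {1..m} (\<tau> \<alpha>))"

definition threshold_cont_mono_level :: "nat \<Rightarrow> (real \<Rightarrow> nat \<Rightarrow> real) \<Rightarrow> bool" where
  "threshold_cont_mono_level m \<tau> \<longleftrightarrow>
     (\<forall>i\<in>{1..m}. continuous_on {0..1} (\<lambda>\<alpha>. \<tau> \<alpha> i) \<and> mono_on {0..1} (\<lambda>\<alpha>. \<tau> \<alpha> i))"

end

theory Submission
  imports Defs
begin

text \<open>Lying strictly below a minimum means lying below every element, so i is rejected exactly
  when p_i < p_(j) for each rank j that is active, i.e. p_(j) > \<tau>(j)
  (\<open>mem_step_down_iff\<close>). The order statistics depend on p alone, so the threshold only
  decides which ranks are active. A minimum of two numbers is below x iff one of them is, so the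
  ranks active for the minimum form the union of the two active sets. A condition over a union is
  the conjunction of the conditions over its parts, which gives the intersection
  (\<open>step_down_min\<close>). Pointwise minima preserve monotonicity
  (\<open>mono_on_min\<close>) and continuity.\<close>

lemma mem_step_down_iff:
  "i \<in> step_down m \<tau> p \<alpha> \<longleftrightarrow>
     i \<in> {1..m} \<and> (\<forall>j\<in>{1..m}. \<tau> \<alpha> j < order_stat m p j \<longrightarrow> p i < order_stat m p j)"
proof -
  define S where "S = {order_stat m p j | j. j \<in> {1..m} \<and> order_stat m p j > \<tau> \<alpha> j}"
  have fin: "finite S"
    unfolding S_def by simp
  \<comment> \<open>If \<open>S\<close> is empty, the bound is \<infinity> on the left and the
    quantifier is vacuous on the right. Otherwise \<open>Min\<close> of the finite set
    \<open>S\<close> exceeds \<open>p i\<close> iff all its elements do.\<close>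
  have "ereal (p i) < step_down_bound m \<tau> p \<alpha> \<longleftrightarrow> (\<forall>x\<in>S. p i < x)"
    unfolding step_down_bound_def S_def[symmetric] using fin by simp
  then show ?thesis
    unfolding step_down_def S_def by blast
qed

lemma step_down_min:
  assumes "\<And>i. i \<in> {1..m} \<Longrightarrow> \<tau> \<alpha> i = min (\<tau>1 \<alpha> i) (\<tau>2 \<alpha> i)"
  shows "step_down m \<tau> p \<alpha> = step_down m \<tau>1 p \<alpha> \<inter> step_down m \<tau>2 p \<alpha>"
proof (rule set_eqI)
  fix i
  \<comment> \<open>A rank is active for \<open>\<tau>\<close> iff it is active for
    \<open>\<tau>1\<close> or for \<open>\<tau>2\<close>; below, x is the j-th order
    statistic.\<close>
  have "\<tau> \<alpha> j < x \<longleftrightarrow> \<tau>1 \<alpha> j < x \<or> \<tau>2 \<alpha> j < x" if "j \<in> {1..m}" for j x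
    using assms[OF that] by (simp only: min_less_iff_disj)
  then show "i \<in> step_down m \<tau> p \<alpha> \<longleftrightarrow> i \<in> step_down m \<tau>1 p \<alpha> \<inter> step_down m \<tau>2 p \<alpha>"
    unfolding Int_iff mem_step_down_iff by blast
qed

text \<open>Both conditions use this: once along the ranks, once along the levels. The minimum is a
  separate function \<open>h\<close>, constrained only on \<open>A\<close>, because
  \<open>\<tau>\<close> is prescribed only for levels in [0,1] and ranks up to
  \<open>m\<close>.\<close>

lemma mono_on_min:
  fixes f g h :: "'a::order \<Rightarrow> 'b::linorder"
  assumes "mono_on A f" "mono_on A g" "\<And>x. x \<in> A \<Longrightarrow> h x = min (f x) (g x)"
  shows "mono_on A h"
proof (rule mono_onI)
  fix x y
  assume "x \<in> A" "y \<in> A" "x \<le> y"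
  then show "h x \<le> h y"
    using assms(3) min.mono[OF mono_onD[OF assms(1)] mono_onD[OF assms(2)]] by simp
qed

theorem mainTheorem7:
  fixes m :: nat and \<tau>1 \<tau>2 \<tau> :: "real \<Rightarrow> nat \<Rightarrow> real"
  assumes "m \<ge> 1"
    and "threshold_function m \<tau>1"
    and "threshold_function m \<tau>2"
    and "\<And>\<alpha> i. \<alpha> \<in> {0..1} \<Longrightarrow> i \<in> {1..m} \<Longrightarrow> \<tau> \<alpha> i = min (\<tau>1 \<alpha> i) (\<tau>2 \<alpha> i)"
  shows "threshold_function m \<tau> \<and>
    (\<forall>p \<in> {1..m} \<rightarrow> {0..1}. \<forall>\<alpha> \<in> {0..1}.
       step_down m \<tau> p \<alpha> = step_down m \<tau>1 p \<alpha> \<inter> step_down m \<tau>2 p \<alpha>) \<and>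
    (threshold_mono_index m \<tau>1 \<and> threshold_cont_mono_level m \<tau>1 \<and>
     threshold_mono_index m \<tau>2 \<and> threshold_cont_mono_level m \<tau>2 \<longrightarrow>
     threshold_mono_index m \<tau> \<and> threshold_cont_mono_level m \<tau>)"
proof (intro conjI ballI impI)
  show "threshold_function m \<tau>"
    using assms(2-4) by (auto simp: threshold_function_def Pi_iff min_def)
  show "step_down m \<tau> p \<alpha> = step_down m \<tau>1 p \<alpha> \<inter> step_down m \<tau>2 p \<alpha>"
    if "\<alpha> \<in> {0..1}" for p \<alpha>
    using assms(4) that by (intro step_down_min) auto
  assume conds: "threshold_mono_index m \<tau>1 \<and> threshold_cont_mono_level m \<tau>1 \<and>
    threshold_mono_index m \<tau>2 \<and> threshold_cont_mono_level m \<tau>2"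
  show "threshold_mono_index m \<tau>"
    unfolding threshold_mono_index_def
  proof
    fix \<alpha> :: real
    assume "\<alpha> \<in> {0..1}"
    then show "mono_on {1..m} (\<tau> \<alpha>)"
      using conds assms(4)[of \<alpha>] unfolding threshold_mono_index_def
      by - (rule mono_on_min[of _ "\<tau>1 \<alpha>" "\<tau>2 \<alpha>"]; blast)
  qed
  show "threshold_cont_mono_level m \<tau>"
    unfolding threshold_cont_mono_level_def
  proof (intro ballI conjI)
    fix i
    assume i: "i \<in> {1..m}"
    have "continuous_on {0..1} (\<lambda>\<alpha>. min (\<tau>1 \<alpha> i) (\<tau>2 \<alpha> i))"
      using conds i unfolding threshold_cont_mono_level_def by (intro continuous_on_min) auto
    \<comment> \<open>Continuity on [0,1] passes from the literal minimum to \<open>\<tau>\<close>,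
      since the two agree there.\<close>
    then show "continuous_on {0..1} (\<lambda>\<alpha>. \<tau> \<alpha> i)"
      by (rule continuous_on_eq) (simp only: assms(4) i)
    show "mono_on {0..1} (\<lambda>\<alpha>. \<tau> \<alpha> i)"
      using conds assms(4) i unfolding threshold_cont_mono_level_def
      by - (rule mono_on_min[of _ "\<lambda>\<alpha>. \<tau>1 \<alpha> i" "\<lambda>\<alpha>. \<tau>2 \<alpha> i"]; blast)
  qed
qed

end
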